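(* For all sufficiently large $m$: $$\mathrm{forb}(m,\{1_{3,1},F_9\})=m+2,\qquad \mathrm{forb}(m,\{1_{2,2},F_9\})=m+3,\qquad \mathrm{forb}(m,\{1_{4,1},F_9\})=m+5.$$
   Context: A matrix is simple if it is a $(0,1)$-matrix with no repeated columns. $F\prec A$ means that some submatrix of $A$ is a row and column permutation of $F$. For a family $\mathcal F$ of $(0,1)$-matrices, $\mathrm{forb}(m,\mathcal F)$ is the maximum number of columns of an $m$-rowed simple matrix $A$ with $F\nprec A$ for all $F\in\mathcal F$. $1_{k,\ell}$ is the $k\times\ell$ matrix with all entries $1$, and $$F_9=\begin{bmatrix}1&0&0\\0&1&0\\0&0&1\\0&0&1\end{bmatrix}.$$ *)

theory Defs
  imports "Jordan_Normal_Form.DL_Submatrix" "HOL-Combinatorics.Permutations"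
begin

definition zero_one_mat :: "nat mat \<Rightarrow> bool" where
  "zero_one_mat A \<longleftrightarrow> elements_mat A \<subseteq> {0, 1}"

definition simple_mat :: "nat mat \<Rightarrow> bool" where
  "simple_mat A \<longleftrightarrow> zero_one_mat A \<and> distinct (cols A)"

definition row_col_permutation :: "nat mat \<Rightarrow> nat mat \<Rightarrow> bool" where
  "row_col_permutation B F \<longleftrightarrow>
     (\<exists>p q. p permutes {..<dim_row F} \<and> q permutes {..<dim_col F} \<and>
        B = mat (dim_row F) (dim_col F) (\<lambda>(i, j). F $$ (p i, q j)))"

definition contained_config :: "nat mat \<Rightarrow> nat mat \<Rightarrow> bool" (infix "\<prec>" 50) where
  "F \<prec> A \<longleftrightarrow> (\<exists>I \<subseteq> {..<dim_row A}. \<exists>J \<subseteq> {..<dim_col A}. row_col_permutation (submatrix A I J) F)"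

definition avoiding_sizes :: "nat \<Rightarrow> nat mat set \<Rightarrow> nat set" where
  "avoiding_sizes m \<F> = {n. \<exists>A \<in> carrier_mat m n. simple_mat A \<and> (\<forall>F\<in>\<F>. \<not> F \<prec> A)}"

lemma finite_avoiding_sizes: "finite (avoiding_sizes m \<F>)"
proof -
  let ?V = "vec_of_list ` {xs. set xs \<subseteq> {0, 1 :: nat} \<and> length xs = m}"
  have fin: "finite ?V"
    by (intro finite_imageI finite_lists_length_eq) simp
  have bound: "n \<le> card ?V" if "n \<in> avoiding_sizes m \<F>" for n
  proof -
    from that obtain A where A: "A \<in> carrier_mat m n" "simple_mat A"
      by (auto simp: avoiding_sizes_def)
    have sub: "set (cols A) \<subseteq> ?V"
    proof
      fix v assume "v \<in> set (cols A)"
      then obtain j where j: "j < n" "v = col A j"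
        using A(1) by (auto simp: cols_def)
      have entries: "A $$ (i, j) \<in> {0, 1}" if "i < m" for i
        using A(2) elements_matI[OF A(1) that j(1) refl]
        by (auto simp: simple_mat_def zero_one_mat_def)
      have len: "length (list_of_vec v) = m"
        using A(1) j by simp
      have "list_of_vec v ! i \<in> {0, 1}" if "i < m" for i
        using A(1) j that entries[OF that] by (simp add: list_of_vec_index)
      with len have "set (list_of_vec v) \<subseteq> {0, 1}"
        by (metis in_set_conv_nth subsetI)
      with len have "list_of_vec v \<in> {xs. set xs \<subseteq> {0, 1} \<and> length xs = m}"
        by blast
      thus "v \<in> ?V"
        by (rule rev_image_eqI) (simp add: vec_list)
    qed
    have "n = card (set (cols A))"
      using A by (simp add: simple_mat_def distinct_card)
    also have "\<dots> \<le> card ?V"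
      by (rule card_mono[OF fin sub])
    finally show ?thesis .
  qed
  show ?thesis
    by (rule finite_subset[OF _ finite_atMost[of "card ?V"]]) (use bound in blast)
qed

text \<open>If every member of the family has a column, the matrix without columns avoids it; then the
  set of sizes is finite and nonempty, so its maximum is well defined.\<close>

lemma zero_in_avoiding_sizes:
  assumes "\<And>F. F \<in> \<F> \<Longrightarrow> dim_col F > 0"
  shows "0 \<in> avoiding_sizes m \<F>"
proof -
  have "\<not> F \<prec> mat m 0 (\<lambda>_. 0)" if "F \<in> \<F>" for F
  proof
    assume "F \<prec> mat m 0 (\<lambda>_. 0)"
    then obtain I J where "row_col_permutation (submatrix (mat m 0 (\<lambda>_. 0)) I J) F"
      by (auto simp: contained_config_def)
    hence "dim_col (submatrix (mat m 0 (\<lambda>_. 0 :: nat)) I J) = dim_col F"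
      by (auto simp: row_col_permutation_def)
    with assms[OF that] show False by (simp add: dim_submatrix)
  qed
  moreover have "simple_mat (mat m 0 (\<lambda>_. 0))"
    by (simp add: simple_mat_def zero_one_mat_def elements_mat_def cols_def)
  ultimately show ?thesis
    unfolding avoiding_sizes_def by (auto intro!: bexI[of _ "mat m 0 (\<lambda>_. 0)"])
qed

definition forb :: "nat \<Rightarrow> nat mat set \<Rightarrow> nat" where
  "forb m \<F> = Max (avoiding_sizes m \<F>)"

definition ones_mat :: "nat \<Rightarrow> nat \<Rightarrow> nat mat" where
  "ones_mat k l = mat k l (\<lambda>_. 1)"

definition F9 :: "nat mat" where
  "F9 = mat_of_rows_list 3
     [[1, 0, 0],
      [0, 1, 0],
      [0, 0, 1],
      [0, 0, 1]]"

end

theory Submission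
  imports Defs "HOL-Library.Disjoint_Sets"
begin

text \<open>
  Read the columns of a simple matrix as a family of subsets of \<open>{..<m}\<close>. The family
  avoids \<open>F9\<close> when no three members \<open>A, B, C\<close> have private elements, at least one
  in each of \<open>A\<close> and \<open>B\<close> and two in \<open>C\<close>.

  If all members have at most three elements and the family is large, it contains a sunflower with
  kernel \<open>Y\<close> and eight members. Three nonempty petals, one of them with two elements, would
  form \<open>F9\<close>, so the petals are points and \<open>Y\<close> has at most two elements. Two petals and
  any member \<open>A\<close> show that \<open>A - Y\<close> has at most one element, so at most
  \<open>m - card Y + 1\<close> members contain \<open>Y\<close>. Moreover, the members missing a given element
  of \<open>Y\<close> leave at most one common point outside \<open>Y\<close>. This gives at most 0, 2 or 6 more
  members for \<open>card Y = 0, 1, 2\<close>, hence the bounds \<open>m + 2\<close> and \<open>m + 5\<close>. When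
  distinct members share at most one point, \<open>card Y = 2\<close> is impossible.

  It remains to treat families in which distinct members share at most one point and some member
  \<open>C\<close> has at least four elements. Then the traces of the other members outside \<open>C\<close> form
  a chain, and the members with a trace of a given size can be counted.
\<close>

section \<open>Matrices as set families\<close>

lemma bij_betw_pick:
  assumes "finite I"
  shows "bij_betw (pick I) {..<card I} I"
proof -
  have inj: "inj_on (pick I) {..<card I}"
    by (rule linorder_inj_onI') (use pick_mono_le in fastforce)
  have "pick I ` {..<card I} \<subseteq> I"
    by (auto intro: pick_in_set_le)
  with inj show ?thesis
    by (metis assms bij_betw_def card_image card_lessThan card_subset_eq)
qed

text \<open>\<open>pick\<close> lists a set in increasing order, while an injection \<open>r\<close>
  lists its image in an arbitrary order; \<open>p\<close> is the permutation that matches the two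
  listings.\<close>

lemma pick_image_permutes:
  assumes "inj_on r {..<k}"
  obtains p where "p permutes {..<k}" "\<And>i. i < k \<Longrightarrow> pick (r ` {..<k}) i = r (p i)"
proof
  let ?I = "r ` {..<k}"
  let ?g = "inv_into {..<k} r \<circ> pick ?I"
  let ?p = "\<lambda>i. if i \<in> {..<k} then ?g i else i"
  have "card ?I = k"
    using assms by (simp add: card_image)
  hence pick: "bij_betw (pick ?I) {..<k} ?I"
    using bij_betw_pick[of ?I] by simp
  moreover have "bij_betw (inv_into {..<k} r) ?I {..<k}"
    using assms by (simp add: bij_betw_inv_into bij_betw_imageI)
  ultimately have "bij_betw ?g {..<k} {..<k}"
    by (rule bij_betw_trans)
  hence "bij_betw ?p {..<k} {..<k}"
    by (rule bij_betw_cong[THEN iffD1, rotated]) simp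
  thus "?p permutes {..<k}"
    by (rule bij_imp_permutes) simp
  show "pick ?I i = r (?p i)" if "i < k" for i
    using that bij_betw_apply[OF pick, of i] by (simp add: f_inv_into_f)
qed

text \<open>A submatrix keeps the chosen rows and columns in increasing order, and permutations then
  rearrange them. Together these choices amount to arbitrary injections on the indices, so
  permutations disappear from here on.\<close>

lemma contained_config_iff:
  "F \<prec> A \<longleftrightarrow> (\<exists>r c. inj_on r {..<dim_row F} \<and> r ` {..<dim_row F} \<subseteq> {..<dim_row A} \<and>
      inj_on c {..<dim_col F} \<and> c ` {..<dim_col F} \<subseteq> {..<dim_col A} \<and>
      (\<forall>i<dim_row F. \<forall>j<dim_col F. F $$ (i, j) = A $$ (r i, c j)))"
  (is "_ \<longleftrightarrow> ?R")
proof
  assume "F \<prec> A"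
  then obtain I J p q where I: "I \<subseteq> {..<dim_row A}" and J: "J \<subseteq> {..<dim_col A}"
    and p: "p permutes {..<dim_row F}" and q: "q permutes {..<dim_col F}"
    and eq: "submatrix A I J = mat (dim_row F) (dim_col F) (\<lambda>(i, j). F $$ (p i, q j))"
    by (auto simp: contained_config_def row_col_permutation_def)
  have sets: "{i. i < dim_row A \<and> i \<in> I} = I" "{j. j < dim_col A \<and> j \<in> J} = J"
    using I J by auto
  have cards: "card I = dim_row F" "card J = dim_col F"
    using arg_cong[OF eq, of dim_row] arg_cong[OF eq, of dim_col]
    by (simp_all add: dim_submatrix sets)
  have bij: "bij_betw (pick I) {..<dim_row F} I" "bij_betw (pick J) {..<dim_col F} J"
    using bij_betw_pick[of I] bij_betw_pick[of J] I J cards by (auto intro: finite_subset)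
  \<comment> \<open>\<open>eq\<close> reads \<open>F\<close> at permuted indices, so an index of
    \<open>F\<close> is first sent back through \<open>p\<close> or \<open>q\<close>.\<close>
  let ?r = "pick I \<circ> inv_into UNIV p" and ?c = "pick J \<circ> inv_into UNIV q"
  have bij': "bij_betw ?r {..<dim_row F} I" "bij_betw ?c {..<dim_col F} J"
    using bij permutes_inv[OF p] permutes_inv[OF q]
    by (auto intro: bij_betw_trans permutes_imp_bij)
  have "F $$ (i, j) = A $$ (?r i, ?c j)" if "i < dim_row F" "j < dim_col F" for i j
  proof -
    have less: "inv_into UNIV p i < dim_row F" "inv_into UNIV q j < dim_col F"
      using that permutes_in_image[OF permutes_inv[OF p], of i]
        permutes_in_image[OF permutes_inv[OF q], of j] by auto
    hence "A $$ (?r i, ?c j) = submatrix A I J $$ (inv_into UNIV p i, inv_into UNIV q j)"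
      by (simp add: submatrix_index sets cards)
    also have "\<dots> = F $$ (i, j)"
      using less permutes_inverses[OF p] permutes_inverses[OF q] by (simp add: eq)
    finally show ?thesis ..
  qed
  with bij' I J show ?R
    unfolding bij_betw_def by (intro exI[of _ ?r] exI[of _ ?c]) auto
next
  assume ?R
  then obtain r c where r: "inj_on r {..<dim_row F}" "r ` {..<dim_row F} \<subseteq> {..<dim_row A}"
    and c: "inj_on c {..<dim_col F}" "c ` {..<dim_col F} \<subseteq> {..<dim_col A}"
    and eq: "\<And>i j. i < dim_row F \<Longrightarrow> j < dim_col F \<Longrightarrow> F $$ (i, j) = A $$ (r i, c j)"
    by auto
  let ?I = "r ` {..<dim_row F}" and ?J = "c ` {..<dim_col F}"
  obtain p where p: "p permutes {..<dim_row F}"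
    "\<And>i. i < dim_row F \<Longrightarrow> pick ?I i = r (p i)"
    using pick_image_permutes[OF r(1)] by blast
  obtain q where q: "q permutes {..<dim_col F}"
    "\<And>i. i < dim_col F \<Longrightarrow> pick ?J i = c (q i)"
    using pick_image_permutes[OF c(1)] by blast
  have sets: "{i. i < dim_row A \<and> i \<in> ?I} = ?I" "{j. j < dim_col A \<and> j \<in> ?J} = ?J"
    using r(2) c(2) by blast+
  have cards: "card ?I = dim_row F" "card ?J = dim_col F"
    using r(1) c(1) by (simp_all add: card_image)
  have "submatrix A ?I ?J = mat (dim_row F) (dim_col F) (\<lambda>(i, j). F $$ (p i, q j))"
  proof (rule eq_matI)
    fix i j
    assume "i < dim_row (mat (dim_row F) (dim_col F) (\<lambda>(i, j). F $$ (p i, q j)))"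
      "j < dim_col (mat (dim_row F) (dim_col F) (\<lambda>(i, j). F $$ (p i, q j)))"
    hence ij: "i < dim_row F" "j < dim_col F" by auto
    moreover have "p i < dim_row F" "q j < dim_col F"
      using ij permutes_in_image[OF p(1), of i] permutes_in_image[OF q(1), of j] by auto
    moreover have "submatrix A ?I ?J $$ (i, j) = A $$ (pick ?I i, pick ?J j)"
      by (rule submatrix_index) (use ij in \<open>simp_all only: sets cards\<close>)
    ultimately show "submatrix A ?I ?J $$ (i, j) =
        mat (dim_row F) (dim_col F) (\<lambda>(i, j). F $$ (p i, q j)) $$ (i, j)"
      by (simp add: p(2) q(2) eq)
  qed (simp_all only: dim_submatrix sets cards dim_row_mat dim_col_mat)
  thus "F \<prec> A"
    unfolding contained_config_def row_col_permutation_def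
    using r(2) c(2) p(1) q(1) by blast
qed

text \<open>A column becomes the set of rows in which it has a 1. The order of the columns is lost,
  but containment disregards it, and distinct columns of a simple matrix remain distinct
  sets.\<close>

definition family_config :: "nat \<Rightarrow> nat mat \<Rightarrow> nat set set \<Rightarrow> bool" where
  "family_config m F \<G> \<longleftrightarrow> (\<exists>r c. inj_on r {..<dim_row F} \<and> r ` {..<dim_row F} \<subseteq> {..<m} \<and>
      inj_on c {..<dim_col F} \<and> c ` {..<dim_col F} \<subseteq> \<G> \<and>
      (\<forall>i<dim_row F. \<forall>j<dim_col F. F $$ (i, j) = of_bool (r i \<in> c j)))"

lemma contained_config_family:
  assumes A: "A \<in> carrier_mat m n"
    and S: "bij_betw S {..<n} \<G>" "\<And>i j. i < m \<Longrightarrow> j < n \<Longrightarrow> A $$ (i, j) = of_bool (i \<in> S j)"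
  shows "F \<prec> A \<longleftrightarrow> family_config m F \<G>"
proof
  assume "F \<prec> A"
  then obtain r c where r: "inj_on r {..<dim_row F}" "r ` {..<dim_row F} \<subseteq> {..<m}"
    and c: "inj_on c {..<dim_col F}" "c ` {..<dim_col F} \<subseteq> {..<n}"
    and eq: "\<And>i j. i < dim_row F \<Longrightarrow> j < dim_col F \<Longrightarrow> F $$ (i, j) = A $$ (r i, c j)"
    using A unfolding contained_config_iff by auto
  have "inj_on (S \<circ> c) {..<dim_col F}"
    using c S(1) by (meson bij_betw_def comp_inj_on inj_on_subset)
  moreover have "(S \<circ> c) ` {..<dim_col F} \<subseteq> \<G>"
    using c(2) S(1) by (auto simp: bij_betw_def)
  moreover have "F $$ (i, j) = of_bool (r i \<in> (S \<circ> c) j)"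
    if "i < dim_row F" "j < dim_col F" for i j
  proof -
    have "r i < m" "c j < n"
      using that r(2) c(2) by auto
    thus ?thesis
      using eq[OF that] S(2)[of "r i" "c j"] by simp
  qed
  ultimately show "family_config m F \<G>"
    unfolding family_config_def using r by (intro exI[of _ r] exI[of _ "S \<circ> c"]) auto
next
  assume "family_config m F \<G>"
  then obtain r c where r: "inj_on r {..<dim_row F}" "r ` {..<dim_row F} \<subseteq> {..<m}"
    and c: "inj_on c {..<dim_col F}" "c ` {..<dim_col F} \<subseteq> \<G>"
    and eq: "\<And>i j. i < dim_row F \<Longrightarrow> j < dim_col F \<Longrightarrow> F $$ (i, j) = of_bool (r i \<in> c j)"
    unfolding family_config_def by auto
  let ?T = "inv_into {..<n} S"
  have T: "bij_betw ?T \<G> {..<n}"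
    using S(1) by (rule bij_betw_inv_into)
  have ST: "S (?T X) = X" if "X \<in> \<G>" for X
    using S(1) that by (simp add: bij_betw_inv_into_right)
  have "inj_on (?T \<circ> c) {..<dim_col F}"
    using c T by (meson bij_betw_def comp_inj_on inj_on_subset)
  moreover have im: "(?T \<circ> c) ` {..<dim_col F} \<subseteq> {..<n}"
    using c(2) T by (auto simp: bij_betw_def)
  moreover have "F $$ (i, j) = A $$ (r i, (?T \<circ> c) j)"
    if "i < dim_row F" "j < dim_col F" for i j
  proof -
    have "r i < m" "(?T \<circ> c) j < n"
      using that im r(2) by auto
    from S(2)[OF this] show ?thesis
      using eq[OF that] ST[of "c j"] c(2) that by auto
  qed
  ultimately show "F \<prec> A"
    unfolding contained_config_iff using r A
    by (intro exI[of _ r] exI[of _ "?T \<circ> c"]) auto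
qed

text \<open>A column with entries 0 and 1 is determined by its set of ones, so passing to these sets
  is injective on the columns of a simple matrix. Conversely, any enumeration of a family yields a
  simple matrix.\<close>

lemma avoiding_sizes_iff:
  "n \<in> avoiding_sizes m \<F> \<longleftrightarrow>
     (\<exists>\<G>\<subseteq>Pow {..<m}. card \<G> = n \<and> (\<forall>F\<in>\<F>. \<not> family_config m F \<G>))"
proof
  assume "n \<in> avoiding_sizes m \<F>"
  then obtain A where A: "A \<in> carrier_mat m n" "simple_mat A" "\<forall>F\<in>\<F>. \<not> F \<prec> A"
    by (auto simp: avoiding_sizes_def)
  let ?S = "\<lambda>j. {i. i < m \<and> A $$ (i, j) = 1}"
  have "A $$ (i, j) \<in> {0, 1}" if "i < m" "j < n" for i j
    using A(2) elements_matI[OF A(1) that refl] by (auto simp: simple_mat_def zero_one_mat_def)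
  hence entry: "A $$ (i, j) = of_bool (i \<in> ?S j)" if "i < m" "j < n" for i j
    using that by fastforce
  have "inj_on ?S {..<n}"
  proof (rule inj_onI)
    fix j k assume jk: "j \<in> {..<n}" "k \<in> {..<n}" "?S j = ?S k"
    have "A $$ (i, j) = A $$ (i, k)" if "i < m" for i
    proof -
      have "i \<in> ?S j \<longleftrightarrow> i \<in> ?S k"
        by (simp only: jk(3))
      thus ?thesis
        using entry[OF that] jk(1,2) by (simp only: lessThan_iff)
    qed
    hence "col A j = col A k"
      using A(1) jk(1,2) by (intro eq_vecI) auto
    hence "cols A ! j = cols A ! k"
      using A(1) jk(1,2) by simp
    thus "j = k"
      using A(1,2) jk(1,2) nth_eq_iff_index_eq[of "cols A" j k] by (simp add: simple_mat_def)
  qed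
  hence bij: "bij_betw ?S {..<n} (?S ` {..<n})"
    by (rule bij_betw_imageI) simp
  show "\<exists>\<G>\<subseteq>Pow {..<m}. card \<G> = n \<and> (\<forall>F\<in>\<F>. \<not> family_config m F \<G>)"
  proof (intro exI[of _ "?S ` {..<n}"] conjI)
    show "card (?S ` {..<n}) = n"
      using bij_betw_same_card[OF bij] by (simp only: card_lessThan)
    show "\<forall>F\<in>\<F>. \<not> family_config m F (?S ` {..<n})"
      using contained_config_family[OF A(1) bij entry] A(3) by blast
  qed auto
next
  assume "\<exists>\<G>\<subseteq>Pow {..<m}. card \<G> = n \<and> (\<forall>F\<in>\<F>. \<not> family_config m F \<G>)"
  then obtain \<G> where G: "\<G> \<subseteq> Pow {..<m}" "card \<G> = n" "\<forall>F\<in>\<F>. \<not> family_config m F \<G>"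
    by blast
  have "finite \<G>"
    using G(1) by (rule finite_subset) simp
  then obtain S where S: "bij_betw S {..<n} \<G>"
    using G(2) ex_bij_betw_nat_finite[of \<G>] by (auto simp: atLeast0LessThan)
  let ?A = "mat m n (\<lambda>(i, j). of_bool (i \<in> S j)) :: nat mat"
  have A: "?A \<in> carrier_mat m n" by simp
  have "F \<prec> ?A \<longleftrightarrow> family_config m F \<G>" for F
    by (rule contained_config_family[OF A S]) simp
  moreover have "zero_one_mat ?A"
    by (auto simp: zero_one_mat_def)
  moreover have "distinct (cols ?A)"
  proof (subst distinct_conv_nth, intro allI impI)
    fix j k assume jk: "j < length (cols ?A)" "k < length (cols ?A)" "j \<noteq> k"
    hence "S j \<noteq> S k" "S j \<in> \<G>" "S k \<in> \<G>"
      using S by (auto simp: bij_betw_def inj_on_def)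
    then obtain i where i: "i < m" "i \<in> S j \<longleftrightarrow> i \<notin> S k"
      using G(1) by blast
    hence "col ?A j $ i \<noteq> col ?A k $ i"
      using jk by auto
    thus "cols ?A ! j \<noteq> cols ?A ! k"
      using jk by (auto simp del: index_col)
  qed
  ultimately show "n \<in> avoiding_sizes m \<F>"
    unfolding avoiding_sizes_def simple_mat_def using A G(3) by blast
qed

section \<open>Values of \<open>forb\<close> and the forbidden matrices in terms of families\<close>

lemma forb_eqI:
  assumes "\<G> \<subseteq> Pow {..<m}" "card \<G> = n" "\<forall>F\<in>\<F>. \<not> family_config m F \<G>"
    and "\<And>\<H>. \<H> \<subseteq> Pow {..<m} \<Longrightarrow> \<forall>F\<in>\<F>. \<not> family_config m F \<H> \<Longrightarrow> card \<H> \<le> n"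
  shows "forb m \<F> = n"
  unfolding forb_def
proof (rule Max_eqI[OF finite_avoiding_sizes])
  show "k \<le> n" if "k \<in> avoiding_sizes m \<F>" for k
    using that assms(4) unfolding avoiding_sizes_iff by auto
  show "n \<in> avoiding_sizes m \<F>"
    unfolding avoiding_sizes_iff using assms(1-3) by blast
qed

text \<open>The rows of an all-ones block are common elements of the sets in \<open>\<H>\<close>.
  Intersecting with \<open>{..<m}\<close> gives the right set of rows even for \<open>l = 0\<close>,
  where \<open>\<Inter>\<H>\<close> is the whole type.\<close>

lemma family_config_ones:
  "family_config m (ones_mat k l) \<G> \<longleftrightarrow>
     (\<exists>\<H>\<subseteq>\<G>. finite \<H> \<and> card \<H> = l \<and> k \<le> card ({..<m} \<inter> \<Inter>\<H>))"
proof
  assume "family_config m (ones_mat k l) \<G>"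
  then obtain r c where r: "inj_on r {..<k}" "r ` {..<k} \<subseteq> {..<m}"
    and c: "inj_on c {..<l}" "c ` {..<l} \<subseteq> \<G>"
    and rc': "\<forall>i<k. \<forall>j<l. ones_mat k l $$ (i, j) = of_bool (r i \<in> c j)"
    unfolding family_config_def by (auto simp: ones_mat_def)
  have rc: "r i \<in> c j" if "i < k" "j < l" for i j
    using rc' that by (auto simp: ones_mat_def of_bool_def split: if_splits)
  have "k = card (r ` {..<k})"
    using r(1) by (simp add: card_image)
  also have "\<dots> \<le> card ({..<m} \<inter> \<Inter>(c ` {..<l}))"
    using r(2) rc by (intro card_mono) auto
  finally show "\<exists>\<H>\<subseteq>\<G>. finite \<H> \<and> card \<H> = l \<and> k \<le> card ({..<m} \<inter> \<Inter>\<H>)"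
    using c by (intro exI[of _ "c ` {..<l}"]) (simp add: card_image)
next
  assume "\<exists>\<H>\<subseteq>\<G>. finite \<H> \<and> card \<H> = l \<and> k \<le> card ({..<m} \<inter> \<Inter>\<H>)"
  then obtain \<H> where H: "\<H> \<subseteq> \<G>" "finite \<H>" "card \<H> = l" "k \<le> card ({..<m} \<inter> \<Inter>\<H>)"
    by blast
  obtain c where c: "bij_betw c {..<l} \<H>"
    using ex_bij_betw_nat_finite[OF H(2)] H(3) by (auto simp: atLeast0LessThan)
  obtain R where R: "R \<subseteq> {..<m} \<inter> \<Inter>\<H>" "card R = k" "finite R"
    using obtain_subset_with_card_n[OF H(4)] by blast
  obtain r where r: "bij_betw r {..<k} R"
    using ex_bij_betw_nat_finite[OF R(3)] R(2) by (auto simp: atLeast0LessThan)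
  have "r i \<in> c j" if "i < k" "j < l" for i j
    using bij_betwE[OF r] bij_betwE[OF c] R(1) that by blast
  thus "family_config m (ones_mat k l) \<G>"
    unfolding family_config_def ones_mat_def using r c R(1) H(1)
    by (intro exI[of _ r] exI[of _ c]) (auto simp: bij_betw_def)
qed

lemma family_config_ones_1:
  assumes "\<G> \<subseteq> Pow {..<m}"
  shows "family_config m (ones_mat k 1) \<G> \<longleftrightarrow> (\<exists>X\<in>\<G>. k \<le> card X)"
proof -
  have "{..<m} \<inter> \<Inter>{X} = X" if "X \<in> \<G>" for X
    using assms that by auto
  moreover have "(\<exists>\<H>\<subseteq>\<G>. finite \<H> \<and> card \<H> = 1 \<and> P \<H>) \<longleftrightarrow> (\<exists>X\<in>\<G>. P {X})" for P
    by (auto simp: card_1_singleton_iff)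
  ultimately show ?thesis
    unfolding family_config_ones by auto
qed

lemma family_config_ones_2:
  assumes "\<G> \<subseteq> Pow {..<m}"
  shows "family_config m (ones_mat k 2) \<G> \<longleftrightarrow> (\<exists>X\<in>\<G>. \<exists>Y\<in>\<G>. X \<noteq> Y \<and> k \<le> card (X \<inter> Y))"
proof -
  have "{..<m} \<inter> \<Inter>{X, Y} = X \<inter> Y" if "X \<in> \<G>" for X Y
    using assms that by auto
  moreover have "(\<exists>\<H>\<subseteq>\<G>. finite \<H> \<and> card \<H> = 2 \<and> P \<H>) \<longleftrightarrow>
      (\<exists>X\<in>\<G>. \<exists>Y\<in>\<G>. X \<noteq> Y \<and> P {X, Y})" for P
  proof
    assume "\<exists>X\<in>\<G>. \<exists>Y\<in>\<G>. X \<noteq> Y \<and> P {X, Y}"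
    then obtain X Y where "X \<in> \<G>" "Y \<in> \<G>" "X \<noteq> Y" "P {X, Y}"
      by blast
    thus "\<exists>\<H>\<subseteq>\<G>. finite \<H> \<and> card \<H> = 2 \<and> P \<H>"
      by (intro exI[of _ "{X, Y}"]) simp
  qed (auto simp: card_2_iff)
  ultimately show ?thesis
    unfolding family_config_ones by auto
qed

text \<open>\<open>C\<close> is the column of \<open>F9\<close> with two ones. The private elements
  force \<open>A\<close>, \<open>B\<close>, \<open>C\<close> to be distinct and all pairs among
  \<open>a\<close>, \<open>b\<close>, \<open>c\<close>, \<open>d\<close> to differ, except for
  \<open>c\<close> and \<open>d\<close>, which lie in the same column. The bound on the rows comes
  from \<open>\<G> \<subseteq> Pow {..<m}\<close> where the notion is applied.\<close>

definition F9_free :: "'a set set \<Rightarrow> bool" where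
  "F9_free \<G> \<longleftrightarrow> \<not> (\<exists>A\<in>\<G>. \<exists>B\<in>\<G>. \<exists>C\<in>\<G>. \<exists>a b c d. a \<in> A - (B \<union> C) \<and> b \<in> B - (A \<union> C) \<and>
     c \<in> C - (A \<union> B) \<and> d \<in> C - (A \<union> B) \<and> c \<noteq> d)"

lemma F9_freeI:
  assumes "\<And>A B C a b c d. A \<in> \<G> \<Longrightarrow> B \<in> \<G> \<Longrightarrow> C \<in> \<G> \<Longrightarrow> a \<in> A - (B \<union> C) \<Longrightarrow>
    b \<in> B - (A \<union> C) \<Longrightarrow> c \<in> C - (A \<union> B) \<Longrightarrow> d \<in> C - (A \<union> B) \<Longrightarrow> c \<noteq> d \<Longrightarrow> False"
  shows "F9_free \<G>"
  unfolding F9_free_def by (rule notI) (elim bexE exE conjE, rule assms)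

lemma F9_freeD:
  assumes "F9_free \<G>" "A \<in> \<G>" "B \<in> \<G>" "C \<in> \<G>" "a \<in> A - (B \<union> C)" "b \<in> B - (A \<union> C)"
    "c \<in> C - (A \<union> B)" "d \<in> C - (A \<union> B)" "c \<noteq> d"
  shows False
  using assms unfolding F9_free_def by blast

lemma F9_free_subset: "F9_free \<H> \<Longrightarrow> \<G> \<subseteq> \<H> \<Longrightarrow> F9_free \<G>"
  unfolding F9_free_def by blast

lemma family_config_F9:
  assumes G: "\<G> \<subseteq> Pow {..<m}"
  shows "family_config m F9 \<G> \<longleftrightarrow> \<not> F9_free \<G>"
proof -
  have dims: "dim_row F9 = 4" "dim_col F9 = 3"
    by (simp_all add: F9_def mat_of_rows_list_def)
  have all: "(\<forall>i<4. P i) \<longleftrightarrow> P 0 \<and> P 1 \<and> P 2 \<and> P 3" "(\<forall>j<3. P j) \<longleftrightarrow> P 0 \<and> P 1 \<and> P 2"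
    for P :: "nat \<Rightarrow> bool"
    by (auto simp: numeral_eq_Suc less_Suc_eq)
  have sets: "{..<4::nat} = {0, 1, 2, 3}" "{..<3::nat} = {0, 1, 2}"
    by auto
  have cfg: "(\<forall>i<4. \<forall>j<3. F9 $$ (i, j) = of_bool (r i \<in> c j)) \<longleftrightarrow>
      r 0 \<in> c 0 - (c 1 \<union> c 2) \<and> r 1 \<in> c 1 - (c 0 \<union> c 2) \<and>
      r 2 \<in> c 2 - (c 0 \<union> c 1) \<and> r 3 \<in> c 2 - (c 0 \<union> c 1)" for r :: "nat \<Rightarrow> nat" and c
    unfolding all by (auto simp: F9_def mat_of_rows_list_def)
  show ?thesis
  proof
    assume "family_config m F9 \<G>"
    then obtain r :: "nat \<Rightarrow> nat" and c :: "nat \<Rightarrow> nat set"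
      where r: "inj_on r {..<4}" and c: "c ` {..<3} \<subseteq> \<G>"
      and rc: "r 0 \<in> c 0 - (c 1 \<union> c 2)" "r 1 \<in> c 1 - (c 0 \<union> c 2)"
      "r 2 \<in> c 2 - (c 0 \<union> c 1)" "r 3 \<in> c 2 - (c 0 \<union> c 1)"
      unfolding family_config_def dims cfg by blast
    moreover have "r 2 \<noteq> r 3"
      using inj_onD[OF r, of 2 3] by auto
    ultimately show "\<not> F9_free \<G>"
      using F9_freeD[of \<G> "c 0" "c 1" "c 2"] by (auto simp: sets)
  next
    assume "\<not> F9_free \<G>"
    then obtain A B C a b c d where *: "A \<in> \<G>" "B \<in> \<G>" "C \<in> \<G>" "a \<in> A - (B \<union> C)"
      "b \<in> B - (A \<union> C)" "c \<in> C - (A \<union> B)" "d \<in> C - (A \<union> B)" "c \<noteq> d"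
      unfolding F9_free_def by blast
    have less: "a < m" "b < m" "c < m" "d < m"
      using * G by auto
    let ?r = "\<lambda>i::nat. if i = 0 then a else if i = 1 then b else if i = 2 then c else d"
    let ?c = "\<lambda>j::nat. if j = 0 then A else if j = 1 then B else C"
    have "inj_on ?r {..<4}" "inj_on ?c {..<3}"
      unfolding sets using * by auto
    moreover have "?r ` {..<4} \<subseteq> {..<m}" "?c ` {..<3} \<subseteq> \<G>"
      using * less by auto
    moreover have "\<forall>i<4. \<forall>j<3. F9 $$ (i, j) = of_bool (?r i \<in> ?c j)"
      unfolding cfg using * by simp
    ultimately show "family_config m F9 \<G>"
      unfolding family_config_def dims by blast
  qed
qed

lemma avoids_ones_1_F9_iff:
  assumes "\<G> \<subseteq> Pow {..<m}"
  shows "(\<forall>F\<in>{ones_mat k 1, F9}. \<not> family_config m F \<G>) \<longleftrightarrow>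
    F9_free \<G> \<and> (\<forall>X\<in>\<G>. card X < k)"
  unfolding ball_simps family_config_F9[OF assms] family_config_ones_1[OF assms] not_le[symmetric]
  by blast

lemma avoids_ones_2_F9_iff:
  assumes "\<G> \<subseteq> Pow {..<m}"
  shows "(\<forall>F\<in>{ones_mat k 2, F9}. \<not> family_config m F \<G>) \<longleftrightarrow>
    F9_free \<G> \<and> (\<forall>X\<in>\<G>. \<forall>Y\<in>\<G>. X \<noteq> Y \<longrightarrow> card (X \<inter> Y) < k)"
  unfolding ball_simps family_config_F9[OF assms] family_config_ones_2[OF assms] not_le[symmetric]
  by blast

section \<open>Sunflowers\<close>

lemma card_ge_2E:
  assumes "2 \<le> card S"
  obtains c d where "c \<in> S" "d \<in> S" "c \<noteq> d"
proof -
  have "finite S"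
    using assms card.infinite by fastforce
  hence "\<not> (\<forall>c\<in>S. \<forall>d\<in>S. c = d)"
    using assms card_le_Suc0_iff_eq[of S] by auto
  thus ?thesis
    using that by blast
qed

text \<open>The Erdos-Rado sunflower lemma, by induction on the size of the sets. A maximal disjoint
  subfamily \<open>M\<close> of nonempty members is a sunflower with empty kernel if it has
  \<open>k\<close> members. Otherwise its small union meets every nonempty member, so some point
  lies in many members, and the induction hypothesis applies to these with the point
  removed.\<close>

lemma sunflower:
  "\<exists>N. \<forall>\<G> :: 'a set set. finite \<G> \<longrightarrow> (\<forall>A\<in>\<G>. finite A \<and> card A \<le> n) \<longrightarrow> N < card \<G> \<longrightarrow>
     (\<exists>Y. \<exists>\<H>\<subseteq>\<G>. card \<H> = k \<and> (\<forall>A\<in>\<H>. \<forall>B\<in>\<H>. A \<noteq> B \<longrightarrow> A \<inter> B = Y))"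
proof (induction n)
  case 0
  have "card \<G> \<le> 1" if "\<forall>A\<in>\<G>. finite A \<and> card A \<le> 0" for \<G> :: "'a set set"
  proof -
    have "\<G> \<subseteq> {{}}"
      using that by auto
    thus ?thesis
      using card_mono[of "{{}}" \<G>] by simp
  qed
  thus ?case
    by (intro exI[of _ 1]) fastforce
next
  case (Suc n)
  then obtain N where N: "\<And>\<G> :: 'a set set. finite \<G> \<Longrightarrow> (\<forall>A\<in>\<G>. finite A \<and> card A \<le> n) \<Longrightarrow>
      N < card \<G> \<Longrightarrow>
      \<exists>Y. \<exists>\<H>\<subseteq>\<G>. card \<H> = k \<and> (\<forall>A\<in>\<H>. \<forall>B\<in>\<H>. A \<noteq> B \<longrightarrow> A \<inter> B = Y)"
    by auto
  show ?case
  \<comment> \<open>The 1 allows for the empty set as a member, and \<open>k * Suc n\<close> bounds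
    the size of \<open>\<Union>M\<close>.\<close>
  proof (intro exI[of _ "1 + (k * Suc n) * N"] allI impI)
    fix \<G> :: "'a set set"
    assume fin: "finite \<G>" and small: "\<forall>A\<in>\<G>. finite A \<and> card A \<le> Suc n"
      and large: "1 + (k * Suc n) * N < card \<G>"
    let ?goal = "\<exists>Y. \<exists>\<H>\<subseteq>\<G>. card \<H> = k \<and> (\<forall>A\<in>\<H>. \<forall>B\<in>\<H>. A \<noteq> B \<longrightarrow> A \<inter> B = Y)"
    let ?\<D> = "{M. M \<subseteq> \<G> - {{}} \<and> disjoint M}"
    have "finite ?\<D>"
      by (rule finite_subset[of _ "Pow \<G>"]) (use fin in auto)
    moreover have "{} \<in> ?\<D>"
      by (simp add: disjoint_def)
    ultimately obtain M where "M \<in> ?\<D>" and max: "\<And>M'. M' \<in> ?\<D> \<Longrightarrow> M \<subseteq> M' \<Longrightarrow> M = M'"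
      using finite_has_maximal[of ?\<D>] by (metis (no_types, lifting) empty_iff)
    hence M: "M \<subseteq> \<G> - {{}}" "disjoint M"
      by auto
    show ?goal
    proof (cases "k \<le> card M")
      case True
      then obtain \<H> where "\<H> \<subseteq> M" "card \<H> = k"
        using obtain_subset_with_card_n by blast
      thus ?thesis
        using M by (intro exI[of _ "{} :: 'a set"] exI[of _ \<H>]) (auto simp: disjoint_def subset_iff)
    next
      case False
      have finM: "finite M"
        using M(1) fin by (meson finite_Diff finite_subset)
      have finW: "finite (\<Union>M)"
        using finM M(1) small by auto
      have "card (\<Union>M) \<le> (\<Sum>A\<in>M. card A)"
        by (rule card_Union_le_sum_card)
      also have "\<dots> \<le> card M * Suc n"
        using sum_bounded_above[of M card "Suc n"] M(1) small by auto
      also have "\<dots> \<le> k * Suc n"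
        using False by (intro mult_right_mono) auto
      finally have cardW: "card (\<Union>M) \<le> k * Suc n" .
      have meets: "A \<inter> \<Union>M \<noteq> {}" if "A \<in> \<G>" "A \<noteq> {}" for A
      proof
        assume empty: "A \<inter> \<Union>M = {}"
        hence "insert A M \<in> ?\<D>"
          using M that by (auto simp: disjoint_def)
        hence "A \<in> M"
          using max by blast
        with empty that(2) show False by blast
      qed
      have "\<G> \<subseteq> insert {} (\<Union>w\<in>\<Union>M. {A \<in> \<G>. w \<in> A})"
        using meets by auto
      hence "card \<G> \<le> card (insert {} (\<Union>w\<in>\<Union>M. {A \<in> \<G>. w \<in> A}))"
        by (rule card_mono[rotated]) (intro finite.insertI finite_UN_I[OF finW], use fin in simp)
      also have "\<dots> \<le> 1 + card (\<Union>w\<in>\<Union>M. {A \<in> \<G>. w \<in> A})"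
        by (simp add: card_insert_le_m1)
      also have "card (\<Union>w\<in>\<Union>M. {A \<in> \<G>. w \<in> A}) \<le> (\<Sum>w\<in>\<Union>M. card {A \<in> \<G>. w \<in> A})"
        by (rule card_UN_le[OF finW])
      finally have bound: "card \<G> \<le> 1 + (\<Sum>w\<in>\<Union>M. card {A \<in> \<G>. w \<in> A})"
        by simp
      have "\<exists>w\<in>\<Union>M. N < card {A \<in> \<G>. w \<in> A}"
      proof (rule ccontr)
        assume "\<not> ?thesis"
        hence "(\<Sum>w\<in>\<Union>M. card {A \<in> \<G>. w \<in> A}) \<le> card (\<Union>M) * N"
          using sum_bounded_above[of "\<Union>M" "\<lambda>w. card {A \<in> \<G>. w \<in> A}" N] by force
        also have "\<dots> \<le> (k * Suc n) * N"
          using cardW by (rule mult_right_mono) simp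
        finally show False
          using bound large by linarith
      qed
      then obtain w where w: "N < card {A \<in> \<G>. w \<in> A}"
        by blast
      \<comment> \<open>Removing \<open>w\<close> lowers the sizes to at most \<open>n\<close> and
        keeps these members distinct. Putting it back turns a sunflower with kernel \<open>Y\<close>
        into one with kernel \<open>insert w Y\<close>.\<close>
      let ?link = "(\<lambda>A. A - {w}) ` {A \<in> \<G>. w \<in> A}"
      have "inj_on (\<lambda>A. A - {w}) {A \<in> \<G>. w \<in> A}"
        by (auto simp: inj_on_def)
      hence "N < card ?link"
        using w by (simp add: card_image)
      moreover have "\<forall>A\<in>?link. finite A \<and> card A \<le> n"
        using small by (auto simp: card_Diff_singleton_if)
      ultimately obtain Y \<H> where H: "\<H> \<subseteq> ?link" "card \<H> = k"
        "\<forall>A\<in>\<H>. \<forall>B\<in>\<H>. A \<noteq> B \<longrightarrow> A \<inter> B = Y"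
        using N[of ?link] fin by auto
      have "inj_on (insert w) \<H>"
        by (rule inj_on_inverseI[of _ "\<lambda>A. A - {w}"]) (use H(1) in auto)
      hence "card (insert w ` \<H>) = k"
        using H(2) by (simp add: card_image)
      moreover have "insert w ` \<H> \<subseteq> \<G>"
        using H(1) by (auto simp: insert_absorb)
      moreover have "\<forall>A\<in>insert w ` \<H>. \<forall>B\<in>insert w ` \<H>. A \<noteq> B \<longrightarrow> A \<inter> B = insert w Y"
        using H(3) by auto
      ultimately show ?thesis
        by (intro exI[of _ "insert w Y"] exI[of _ "insert w ` \<H>"]) auto
    qed
  qed
qed

text \<open>A petal with two points and two further nonempty petals would form \<open>F9\<close>, so
  all nonempty petals are points. The set of these points, rather than \<open>\<H>\<close>, is what
  the later counting uses.\<close>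

lemma F9_free_sunflower_kernel:
  assumes free: "F9_free \<G>" and fin: "finite \<G>" "\<And>A. A \<in> \<G> \<Longrightarrow> finite A"
    and H: "\<H> \<subseteq> \<G>" "k < card \<H>" "\<And>A B. A \<in> \<H> \<Longrightarrow> B \<in> \<H> \<Longrightarrow> A \<noteq> B \<Longrightarrow> A \<inter> B = Y"
    and k: "3 \<le> k"
  shows "k \<le> card {x. x \<notin> Y \<and> insert x Y \<in> \<G>}" "finite {x. x \<notin> Y \<and> insert x Y \<in> \<G>}"
proof -
  let ?X = "{x. x \<notin> Y \<and> insert x Y \<in> \<G>}"
  \<comment> \<open>The kernel itself may belong to \<open>\<H>\<close>, with an empty petal; this
    costs one member and turns \<open>k < card \<H>\<close> into \<open>k\<close>.\<close>
  let ?H = "\<H> - {Y}"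
  have "?X \<subseteq> \<Union>\<G>"
    by auto
  thus finX: "finite ?X"
    using fin by (meson finite_Union finite_subset)
  have finH: "finite \<H>"
    using H(1) fin(1) by (rule finite_subset)
  have cardH: "k \<le> card ?H"
    using H(2) finH by (auto simp: card_Diff_singleton_if)
  have sup: "Y \<subset> A" if "A \<in> ?H" for A
  proof -
    have "1 \<le> card (?H - {A})"
      using cardH k finH that by simp
    then obtain B where "B \<in> ?H - {A}"
      by (metis card.empty ex_in_conv not_one_le_zero)
    thus ?thesis
      using H(3)[of A B] that by blast
  qed
  have "\<exists>x. x \<notin> Y \<and> C = insert x Y" if C: "C \<in> ?H" for C
  proof (rule ccontr)
    assume contra: "\<not> ?thesis"
    obtain c where c: "c \<in> C" "c \<notin> Y"
      using sup[OF C] by blast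
    moreover obtain d where d: "d \<in> C" "d \<notin> Y" "d \<noteq> c"
      using contra c sup[OF C] by blast
    \<comment> \<open>Here \<open>3 \<le> k\<close> provides two members besides \<open>C\<close>,
      to be the columns of \<open>F9\<close> with a single 1.\<close>
    have "2 \<le> card (?H - {C})"
      using cardH k finH C by simp
    then obtain A B where AB: "A \<in> ?H - {C}" "B \<in> ?H - {C}" "A \<noteq> B"
      by (rule card_ge_2E)
    then obtain a b where ab: "a \<in> A" "a \<notin> Y" "b \<in> B" "b \<notin> Y"
      using sup[of A] sup[of B] by blast
    have int: "A \<inter> B = Y" "A \<inter> C = Y" "B \<inter> C = Y"
      using H(3)[of A B] H(3)[of A C] H(3)[of B C] AB C by auto
    have "A \<in> \<G>" "B \<in> \<G>" "C \<in> \<G>"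
      using AB C H(1) by auto
    moreover have "a \<in> A - (B \<union> C)" "b \<in> B - (A \<union> C)" "c \<in> C - (A \<union> B)" "d \<in> C - (A \<union> B)"
      using ab c d int by blast+
    ultimately show False
      using F9_freeD[OF free, of A B C a b c d] d(3) by auto
  qed
  hence "?H \<subseteq> (\<lambda>x. insert x Y) ` ?X"
    using H(1) by blast
  hence "card ?H \<le> card ?X"
    using finX by (meson card_image_le card_mono finite_imageI le_trans)
  with cardH show "k \<le> card ?X"
    by simp
qed

section \<open>Families of small sets around a sunflower\<close>

lemma ex_outside:
  assumes "finite S" "card S < card X"
  shows "\<exists>x\<in>X. x \<notin> S"
proof (rule ccontr)
  assume "\<not> ?thesis"
  hence "X \<subseteq> S"
    by blast
  thus False
    using card_mono[OF assms(1), of X] assms(2) by simp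
qed

text \<open>Two members cover at most six points, so seven points in \<open>X\<close> always leave a
  petal outside both. Such petals complete a copy of \<open>F9\<close> unless the members are close
  to \<open>Y\<close>; the members containing \<open>Y\<close> and the others are then counted
  separately.\<close>

lemma F9_free_sunflower_bound:
  fixes \<G> :: "nat set set"
  assumes sub: "\<G> \<subseteq> Pow {..<m}" and free: "F9_free \<G>" and small: "\<And>A. A \<in> \<G> \<Longrightarrow> card A \<le> 3"
    and X: "X = {x. x \<notin> Y \<and> insert x Y \<in> \<G>}" "finite X" "7 \<le> card X"
  shows "card \<G> \<le> m + 2 \<or> card Y = 2 \<and> card \<G> \<le> m + 5"
proof -
  have finG: "finite \<G>"
    using sub by (rule finite_subset) simp
  have fin: "finite A" if "A \<in> \<G>" for A
    using that sub by (meson Pow_iff finite_lessThan finite_subset subsetD)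
  obtain x0 where x0: "x0 \<in> X"
    using X(3) by fastforce
  have Ysub: "Y \<subseteq> {..<m}" and finY: "finite Y"
    using x0 sub fin[of "insert x0 Y"] by (auto simp: X(1))
  have "card (insert x0 Y) \<le> 3"
    using x0 small by (auto simp: X(1))
  hence cardY: "card Y \<le> 2"
    using x0 finY by (simp add: X(1))
  \<comment> \<open>Two petals outside \<open>A\<close> are the columns with a single 1, and
    \<open>A\<close> would be the column with private elements \<open>s\<close> and
    \<open>t\<close>.\<close>
  have trace: "s = t" if A: "A \<in> \<G>" and st: "s \<in> A - Y" "t \<in> A - Y" for A s t
  proof (rule ccontr)
    assume "s \<noteq> t"
    obtain x where x: "x \<in> X" "x \<notin> A"
      using ex_outside[of A X] fin[OF A] small[OF A] X(3) by auto
    obtain y where y: "y \<in> X" "y \<notin> insert x A"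
      using ex_outside[of "insert x A" X] fin[OF A] small[OF A] X(3) x(2) by auto
    have "insert x Y \<in> \<G>" "insert y Y \<in> \<G>"
      using x y by (auto simp: X(1))
    moreover have "x \<in> insert x Y - (insert y Y \<union> A)" "y \<in> insert y Y - (insert x Y \<union> A)"
      "s \<in> A - (insert x Y \<union> insert y Y)" "t \<in> A - (insert x Y \<union> insert y Y)"
      using x y st by (auto simp: X(1))
    ultimately show False
      using F9_freeD[OF free, of "insert x Y" "insert y Y" A x y s t] A \<open>s \<noteq> t\<close> by simp
  qed
  \<comment> \<open>The roles are now exchanged: the column with two private elements is a petal
    \<open>insert x Y\<close>, and these elements are \<open>x\<close> and the point
    \<open>y\<close> of the kernel missed by \<open>A\<close> and \<open>B\<close>.\<close>
  have same: "s = t"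
    if y: "y \<in> Y" "y \<notin> A" "y \<notin> B" and AB: "A \<in> \<G>" "B \<in> \<G>" and st: "s \<in> A - Y" "t \<in> B - Y"
    for y A B s t
  proof (rule ccontr)
    assume "s \<noteq> t"
    have "card (A \<union> B) \<le> 6"
      using card_Un_le[of A B] small[OF AB(1)] small[OF AB(2)] by simp
    then obtain x where x: "x \<in> X" "x \<notin> A \<union> B"
      using ex_outside[of "A \<union> B" X] fin AB X(3) by auto
    have "insert x Y \<in> \<G>"
      using x by (auto simp: X(1))
    moreover have "s \<notin> B" "t \<notin> A"
      using trace[OF AB(2), of s t] trace[OF AB(1), of s t] st \<open>s \<noteq> t\<close> by auto
    moreover have "s \<noteq> x" "t \<noteq> x" "x \<noteq> y"
      using x y st by (auto simp: X(1))
    ultimately show False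
      using F9_freeD[OF free AB, of "insert x Y" s t x y] y st x by simp
  qed
  have single: "\<exists>s. \<forall>A\<in>\<G>. y \<notin> A \<longrightarrow> A - Y \<subseteq> {s}" if "y \<in> Y" for y
    using same[OF that] by blast
  let ?sup = "insert Y ((\<lambda>x. insert x Y) ` ({..<m} - Y))"
  have "A \<in> ?sup" if A: "A \<in> \<G>" "Y \<subseteq> A" for A
  proof (cases "A = Y")
    case False
    then obtain x where x: "x \<in> A - Y"
      using A(2) by blast
    hence "A = insert x Y"
      using trace[OF A(1)] A(2) by blast
    thus ?thesis
      using x A(1) sub by blast
  qed simp
  hence split: "\<G> \<subseteq> ?sup \<union> {A \<in> \<G>. \<not> Y \<subseteq> A}"
    by blast
  have "card ?sup \<le> 1 + (m - card Y)"
  proof -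
    have "card ?sup \<le> 1 + card ((\<lambda>x. insert x Y) ` ({..<m} - Y))"
      by (simp add: card_insert_le_m1)
    also have "\<dots> \<le> 1 + card ({..<m} - Y)"
      by (intro add_left_mono card_image_le) simp
    finally show ?thesis
      using Ysub finY by (simp add: card_Diff_subset)
  qed
  moreover have "card \<G> \<le> card ?sup + card {A \<in> \<G>. \<not> Y \<subseteq> A}"
    using card_mono[OF _ split] card_Un_le[of ?sup "{A \<in> \<G>. \<not> Y \<subseteq> A}"] finG by simp
  ultimately have bound: "card \<G> \<le> 1 + (m - card Y) + card {A \<in> \<G>. \<not> Y \<subseteq> A}"
    by simp
  have Ym: "card Y \<le> m"
    using card_mono[OF _ Ysub] by simp
  \<comment> \<open>A list bounds the number of candidates by its length even when some of its
    entries coincide.\<close>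
  have listed: "card {A \<in> \<G>. \<not> Y \<subseteq> A} \<le> length xs" if "{A \<in> \<G>. \<not> Y \<subseteq> A} \<subseteq> set xs" for xs
    using card_mono[OF _ that] card_length[of xs] by simp
  consider "card Y = 0" | "card Y = 1" | "card Y = 2"
    using cardY by linarith
  thus ?thesis
  proof cases
    case 1
    hence "Y = {}"
      using finY by simp
    thus ?thesis
      using bound by simp
  next
    case 2
    then obtain w where Y: "Y = {w}"
      by (auto simp: card_1_singleton_iff)
    then obtain s where s: "\<And>A. A \<in> \<G> \<Longrightarrow> w \<notin> A \<Longrightarrow> A - Y \<subseteq> {s}"
      using single[of w] by blast
    have "{A \<in> \<G>. \<not> Y \<subseteq> A} \<subseteq> set [{}, {s}]"
      using s unfolding Y by auto
    from listed[OF this] show ?thesis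
      using bound 2 Ym by simp
  next
    case 3
    then obtain v w where Y: "Y = {v, w}" "v \<noteq> w"
      by (auto simp: card_2_iff)
    obtain s where s: "\<And>A. A \<in> \<G> \<Longrightarrow> v \<notin> A \<Longrightarrow> A - Y \<subseteq> {s}"
      using single[of v] Y by blast
    obtain t where t: "\<And>A. A \<in> \<G> \<Longrightarrow> w \<notin> A \<Longrightarrow> A - Y \<subseteq> {t}"
      using single[of w] Y by blast
    \<comment> \<open>A member that contains \<open>v\<close> misses \<open>w\<close>, which leaves
      \<open>{v}\<close> and \<open>{v, t}\<close>; a member that misses \<open>v\<close> is one of
      the four subsets of \<open>{w, s}\<close>.\<close>
    have "A \<in> set [{}, {s}, {w}, {w, s}, {v}, {v, t}]" if A: "A \<in> {A \<in> \<G>. \<not> Y \<subseteq> A}" for A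
    proof (cases "v \<in> A")
      case True
      hence "w \<notin> A"
        using A Y by auto
      hence "A \<subseteq> {v, t}"
        using t[of A] A Y by auto
      hence "A = {v} \<or> A = {v, t}"
        using True by blast
      thus ?thesis
        by (elim disjE) simp_all
    next
      case False
      hence "A \<subseteq> {w, s}"
        using s[of A] A Y by auto
      hence "A = {} \<or> A = {s} \<or> A = {w} \<or> A = {w, s}"
        by blast
      thus ?thesis
        by (elim disjE) simp_all
    qed
    hence "{A \<in> \<G>. \<not> Y \<subseteq> A} \<subseteq> set [{}, {s}, {w}, {w, s}, {v}, {v, t}]"
      by blast
    from listed[OF this] have "card {A \<in> \<G>. \<not> Y \<subseteq> A} \<le> 6"
      by simp
    hence "card \<G> \<le> m + 5"
      using bound 3 Ym by linarith
    with 3 show ?thesis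
      by blast
  qed
qed

text \<open>A sunflower with eight members has at least seven point petals. In the exceptional case
  of a two-point kernel, two petals give triples that share two points. This consequence is stated
  without the kernel, so that it can be refuted directly for sets of size below three and for linear
  families.\<close>

lemma F9_free_triples_bound:
  "\<exists>N. \<forall>m :: nat. \<forall>\<G>\<subseteq>Pow {..<m}. F9_free \<G> \<longrightarrow> (\<forall>A\<in>\<G>. card A \<le> 3) \<longrightarrow> N < card \<G> \<longrightarrow>
     card \<G> \<le> m + 2 \<or>
     card \<G> \<le> m + 5 \<and> (\<exists>A\<in>\<G>. \<exists>B\<in>\<G>. A \<noteq> B \<and> card A = 3 \<and> card (A \<inter> B) = 2)"
proof -
  obtain N where N: "\<And>\<G> :: nat set set. finite \<G> \<Longrightarrow> (\<forall>A\<in>\<G>. finite A \<and> card A \<le> 3) \<Longrightarrow> N < card \<G> \<Longrightarrow>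
     \<exists>Y. \<exists>\<H>\<subseteq>\<G>. card \<H> = 8 \<and> (\<forall>A\<in>\<H>. \<forall>B\<in>\<H>. A \<noteq> B \<longrightarrow> A \<inter> B = Y)"
    using sunflower[of 3 8, where 'a = nat] by auto
  show ?thesis
  proof (intro exI[of _ N] allI impI)
    fix m and \<G> :: "nat set set"
    assume sub: "\<G> \<subseteq> Pow {..<m}" and free: "F9_free \<G>" and small: "\<forall>A\<in>\<G>. card A \<le> 3"
      and large: "N < card \<G>"
    have finG: "finite \<G>"
      using sub by (rule finite_subset) simp
    have fin: "finite A" if "A \<in> \<G>" for A
      using that sub by (meson Pow_iff finite_lessThan finite_subset subsetD)
    obtain Y \<H> where H: "\<H> \<subseteq> \<G>" "card \<H> = 8" "\<forall>A\<in>\<H>. \<forall>B\<in>\<H>. A \<noteq> B \<longrightarrow> A \<inter> B = Y"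
      using N[OF finG _ large] fin small by auto
    define X where "X = {x. x \<notin> Y \<and> insert x Y \<in> \<G>}"
    have X: "finite X" "7 \<le> card X"
      using F9_free_sunflower_kernel[OF free finG fin H(1), of 7 Y] H(2,3) unfolding X_def by simp_all
    have "\<exists>A\<in>\<G>. \<exists>B\<in>\<G>. A \<noteq> B \<and> card A = 3 \<and> card (A \<inter> B) = 2" if Y: "card Y = 2"
    proof -
      obtain x y where xy: "x \<in> X" "y \<in> X" "x \<noteq> y"
        using X(2) card_ge_2E[of X] by auto
      hence "insert x Y \<noteq> insert y Y" "insert x Y \<inter> insert y Y = Y"
        by (auto simp: X_def)
      moreover have "card (insert x Y) = 3"
        using xy(1) Y card.infinite[of Y] by (cases "finite Y") (auto simp: X_def)
      ultimately show ?thesis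
        using xy Y by (intro bexI[of _ "insert x Y"] bexI[of _ "insert y Y"]) (auto simp: X_def)
    qed
    thus "card \<G> \<le> m + 2 \<or>
        card \<G> \<le> m + 5 \<and> (\<exists>A\<in>\<G>. \<exists>B\<in>\<G>. A \<noteq> B \<and> card A = 3 \<and> card (A \<inter> B) = 2)"
      using F9_free_sunflower_bound[OF sub free _ X_def X] small by blast
  qed
qed

section \<open>Linear families with a large member\<close>

text \<open>Two other members meet \<open>C\<close> in at most one point each, so \<open>C\<close>
  keeps two private points and is the third column of \<open>F9\<close> as soon as the traces
  outside \<open>C\<close> are not nested. Nested traces leave few kinds of members: at most one
  with a trace of size two or more, and otherwise subsets of \<open>insert t C\<close> with at most
  one point in \<open>C\<close>, for a fixed \<open>t\<close>.\<close>

lemma F9_free_linear_bound: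
  fixes \<G> :: "nat set set"
  assumes sub: "\<G> \<subseteq> Pow {..<m}" and free: "F9_free \<G>"
    and linear: "\<And>A B. A \<in> \<G> \<Longrightarrow> B \<in> \<G> \<Longrightarrow> A \<noteq> B \<Longrightarrow> card (A \<inter> B) \<le> 1"
    and C: "C \<in> \<G>" "4 \<le> card C" and m: "5 \<le> m"
  shows "card \<G> \<le> m + 3"
proof -
  have fin: "finite A" if "A \<in> \<G>" for A
    using that sub by (meson Pow_iff finite_lessThan finite_subset subsetD)
  have Cm: "C \<subseteq> {..<m}"
    using C sub by auto
  have chain: "A - C \<subseteq> B - C \<or> B - C \<subseteq> A - C"
    if AB: "A \<in> \<G>" "B \<in> \<G>" "A \<noteq> C" "B \<noteq> C" for A B
  proof (rule ccontr)
    assume "\<not> ?thesis"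
    then obtain a b where ab: "a \<in> A - (B \<union> C)" "b \<in> B - (A \<union> C)"
      by blast
    have "card (C \<inter> (A \<union> B)) \<le> card (A \<inter> C) + card (B \<inter> C)"
      using card_Un_le[of "A \<inter> C" "B \<inter> C"] by (simp add: Int_Un_distrib Int_commute)
    also have "\<dots> \<le> 2"
      using linear[OF AB(1) C(1) AB(3)] linear[OF AB(2) C(1) AB(4)] by simp
    finally have "2 \<le> card (C - (A \<union> B))"
      using C fin by (simp add: card_Diff_subset_Int)
    then obtain c d where "c \<in> C - (A \<union> B)" "d \<in> C - (A \<union> B)" "c \<noteq> d"
      by (rule card_ge_2E)
    thus False
      using F9_freeD[OF free AB(1,2) C(1) ab] by blast
  qed
  define E where "E = {A \<in> \<G>. A \<noteq> C \<and> 2 \<le> card (A - C)}"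
  \<comment> \<open>The smaller trace lies in both members and has two points, against
    linearity.\<close>
  have "A = B" if AB: "A \<in> E" "B \<in> E" "A - C \<subseteq> B - C" for A B
  proof (rule ccontr)
    assume "A \<noteq> B"
    have "card (A - C) \<le> card (A \<inter> B)"
      using AB fin by (intro card_mono) (auto simp: E_def)
    thus False
      using linear[of A B] AB \<open>A \<noteq> B\<close> by (auto simp: E_def)
  qed
  hence E_unique: "A = B" if "A \<in> E" "B \<in> E" for A B
    using chain[of A B] that by (auto simp: E_def)
  have finE: "finite E"
    by (rule finite_subset[of _ "Pow {..<m}"]) (use sub in \<open>auto simp: E_def\<close>)
  have cardE: "card E \<le> 1"
    using E_unique finE card_le_Suc0_iff_eq[of E] by auto
  obtain t where t: "t \<notin> C" "\<And>A. A \<in> \<G> \<Longrightarrow> card (A - C) = 1 \<Longrightarrow> A - C = {t}"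
  proof (cases "\<exists>A\<in>\<G>. card (A - C) = 1")
    case True
    then obtain A t where A: "A \<in> \<G>" "A - C = {t}"
      by (auto simp: card_1_singleton_iff)
    have "B - C = {t}" if B: "B \<in> \<G>" "card (B - C) = 1" for B
    proof -
      obtain u where u: "B - C = {u}"
        using B(2) by (auto simp: card_1_singleton_iff)
      have "A \<noteq> C" "B \<noteq> C"
        using A u by auto
      thus ?thesis
        using chain[OF A(1) B(1)] A u by auto
    qed
    thus ?thesis
      using that[of t] A by auto
  next
    case False
    \<comment> \<open>No trace has size one, so any point outside \<open>C\<close> can serve as
      \<open>t\<close>; \<open>m\<close> is a default choice.\<close>
    have "m \<notin> C"
      using Cm by auto
    thus ?thesis
      using that False by auto
  qed
  define R where "R = {c \<in> C. {c} \<in> \<G>}"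
  define S where "S = {c \<in> C. {t, c} \<in> \<G>}"
  have RS: "R \<subseteq> C" "S \<subseteq> C"
    by (auto simp: R_def S_def)
  have finC: "finite C"
    using C(1) by (rule fin)
  have finRS: "finite R" "finite S"
    using RS finC by (auto intro: finite_subset)
  have "A \<in> set [C, {}, {t}] \<union> E \<union> (\<lambda>c. {c}) ` R \<union> (\<lambda>c. {t, c}) ` S" if A: "A \<in> \<G>" for A
  proof (cases "A = C")
    case False
    have int: "A \<inter> C = {} \<or> (\<exists>c\<in>C. A \<inter> C = {c})"
    proof (cases "card (A \<inter> C) = 0")
      case True
      thus ?thesis
        using finC by simp
    next
      case nonzero: False
      have "card (A \<inter> C) = 1"
        using linear[OF A C(1) False] nonzero by simp
      thus ?thesis
        by (auto simp: card_1_singleton_iff)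
    qed
    consider "card (A - C) = 0" | "card (A - C) = 1" | "2 \<le> card (A - C)"
      by linarith
    thus ?thesis
    proof cases
      case 1
      hence "A = A \<inter> C"
        using fin[OF A] by auto
      thus ?thesis
        using int A by (auto simp: R_def)
    next
      case 2
      hence "A = insert t (A \<inter> C)"
        using t(2)[OF A] by blast
      thus ?thesis
        using int A by (auto simp: S_def)
    next
      case 3
      thus ?thesis
        using A False by (simp add: E_def)
    qed
  qed simp
  hence "\<G> \<subseteq> set [C, {}, {t}] \<union> E \<union> (\<lambda>c. {c}) ` R \<union> (\<lambda>c. {t, c}) ` S"
    by blast
  hence "card \<G> \<le> card (set [C, {}, {t}] \<union> E \<union> (\<lambda>c. {c}) ` R \<union> (\<lambda>c. {t, c}) ` S)"
    using finE finRS by (intro card_mono) auto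
  also have "\<dots> \<le> card (set [C, {}, {t}]) + card E + card ((\<lambda>c. {c}) ` R) + card ((\<lambda>c. {t, c}) ` S)"
    by (intro order.trans[OF card_Un_le] add_right_mono order.refl)
  also have "\<dots> \<le> 3 + card E + card R + card S"
    using card_length[of "[C, {}, {t}]"] finRS by (intro add_mono card_image_le) auto
  finally have bound: "card \<G> \<le> 3 + card E + card R + card S" .
  have compl: "card C + card ({..<m} - C) = m"
    using Cm finC card_mono[OF _ Cm] by (simp add: card_Diff_subset)
  \<comment> \<open>A member of \<open>E\<close> occupies two points outside \<open>C\<close>: one
    pays for the member itself, the other for an additional 1 in the case where \<open>S\<close> is
    nonempty.\<close>
  have E_le: "2 * card E \<le> card ({..<m} - C)"
  proof (cases "E = {}")
    case False
    then obtain A where A: "A \<in> E"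
      by blast
    have "card (A - C) \<le> card ({..<m} - C)"
      using A sub by (intro card_mono) (auto simp: E_def)
    thus ?thesis
      using A cardE by (auto simp: E_def)
  qed simp
  \<comment> \<open>Two singletons in \<open>C\<close> avoiding \<open>p\<close> would form
    \<open>F9\<close> with the pair \<open>{t, p}\<close>.\<close>
  have R_le: "card (R - {p}) \<le> 1" if p: "p \<in> S" for p
  proof (rule ccontr)
    assume "\<not> ?thesis"
    then obtain a b where ab: "a \<in> R - {p}" "b \<in> R - {p}" "a \<noteq> b"
      using card_ge_2E[of "R - {p}"] by auto
    have "t \<noteq> a" "t \<noteq> b" "t \<noteq> p"
      using t(1) ab RS p by auto
    thus False
      using F9_freeD[OF free, of "{a}" "{b}" "{t, p}" a b t p] ab p by (auto simp: R_def S_def)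
  qed
  have cards: "card R \<le> card C" "card S \<le> card C"
    using RS finC by (auto intro: card_mono)
  show ?thesis
  proof (cases "S = {}")
    case True
    thus ?thesis
      using bound cards(1) E_le compl by simp
  next
    case False
    then obtain p where p: "p \<in> S"
      by blast
    hence "t \<in> {..<m} - C"
      using sub t(1) by (auto simp: S_def)
    hence "1 \<le> card ({..<m} - C)"
      by (metis One_nat_def Suc_leI card_gt_0_iff empty_iff finite_Diff finite_lessThan)
    hence E1: "card C + card E + 1 \<le> m"
      using E_le compl by linarith
    show ?thesis
    proof (cases "card R \<le> 1")
      case True
      thus ?thesis
        using bound E1 cards(2) by linarith
    next
      case R: False
      \<comment> \<open>If \<open>q\<close> were not in \<open>R\<close>, removing it would leave
        \<open>R\<close> with at least two elements. With \<open>S\<close> inside \<open>R\<close>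
        and \<open>card R \<le> 2\<close>, the bound is 3 + 1 + 2 + 2 = 8, which is where
        \<open>5 \<le> m\<close> enters.\<close>
      have "S \<subseteq> R"
      proof
        fix q assume q: "q \<in> S"
        show "q \<in> R"
          using R_le[OF q] R by (cases "q \<in> R") auto
      qed
      hence "card S \<le> card R"
        using finRS by (intro card_mono)
      moreover have "card R \<le> 2"
        using R_le[OF p] finRS by (simp add: card_Diff_singleton_if split: if_splits)
      ultimately show ?thesis
        using bound cardE m by linarith
    qed
  qed
qed

section \<open>Extremal families\<close>

text \<open>The extremal case of a one-point kernel, here \<open>{0}\<close>: the sets
  \<open>{}\<close> and \<open>{1}\<close> are the two members that miss the kernel.\<close>

definition star_family :: "nat \<Rightarrow> nat set set" where
  "star_family m = {{}, {0}, {1}} \<union> (\<lambda>i. {0, i}) ` {1..<m}"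

lemma star_family_subset: "2 \<le> m \<Longrightarrow> star_family m \<subseteq> Pow {..<m}"
  by (auto simp: star_family_def)

lemma card_star_family:
  assumes "2 \<le> m"
  shows "card (star_family m) = m + 2"
proof -
  have "inj_on (\<lambda>i::nat. {0, i}) {1..<m}"
    by (auto simp: inj_on_def doubleton_eq_iff)
  hence "card ((\<lambda>i::nat. {0, i}) ` {1..<m}) = m - 1"
    by (simp add: card_image)
  moreover have "card {{}, {0}, {1 :: nat}} = 3"
    by simp
  moreover have "{0, i} \<notin> {{}, {0}, {1}}" if "i \<in> {1..<m}" for i
    using that by simp
  hence "{{}, {0}, {1}} \<inter> (\<lambda>i::nat. {0, i}) ` {1..<m} = {}"
    by blast
  ultimately show ?thesis
    using assms card_Un_disjoint[of "{{}, {0}, {1 :: nat}}" "(\<lambda>i. {0, i}) ` {1..<m}"]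
    by (simp add: star_family_def)
qed

text \<open>The additional set \<open>{1..<m}\<close> lets one lemma serve both \<open>m + 2\<close>
  and \<open>m + 3\<close>. If it is \<open>C\<close>, then \<open>0\<close> is the only possible
  private element of \<open>A\<close> and of \<open>B\<close>. Otherwise \<open>C\<close> is a pair
  \<open>{0, i}\<close> with both elements private, so \<open>A\<close> and \<open>B\<close> miss
  \<open>0\<close> and belong to a chain.\<close>

lemma F9_free_star_family: "F9_free (insert {1..<m} (star_family m))"
proof (rule F9_freeI)
  let ?G = "insert {1..<m} (star_family m)"
  fix A B C a b c d
  assume G: "A \<in> ?G" "B \<in> ?G" "C \<in> ?G"
    and "a \<in> A - (B \<union> C)" "b \<in> B - (A \<union> C)" "c \<in> C - (A \<union> B)" "d \<in> C - (A \<union> B)" "c \<noteq> d"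
  hence mem: "a \<in> A" "a \<notin> B \<union> C" "b \<in> B" "b \<notin> A \<union> C" "c \<in> C" "c \<notin> A \<union> B" "d \<in> C" "d \<notin> A \<union> B"
    by auto
  \<comment> \<open>No lower bound on \<open>m\<close> is assumed, so the points \<open>0\<close>
    and \<open>1\<close> of the fixed members are listed apart.\<close>
  have less: "x = 0 \<or> x = 1 \<or> x < m" if "X \<in> ?G" "x \<in> X" for x X
    using that by (auto simp: star_family_def)
  have without: "X = {} \<or> X = {1} \<or> X = {1..<m}" if "X \<in> ?G" "0 \<notin> X" for X
    using that by (auto simp: star_family_def)
  have "0 \<in> C \<or> C = {1..<m}"
    using without[OF G(3)] mem(5,7) \<open>c \<noteq> d\<close> by auto
  thus False
  proof
    assume C: "C = {1..<m}"
    have "1 < m"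
      using mem(5) C by auto
    hence "a = 0" "b = 0"
      using C mem less[OF G(1) mem(1)] less[OF G(2) mem(3)] by auto
    thus False
      using mem by simp
  next
    assume "0 \<in> C"
    then obtain i where "C = {0, i}"
      using G(3) mem(5,7) \<open>c \<noteq> d\<close> by (auto simp: star_family_def)
    hence "0 \<notin> A" "0 \<notin> B"
      using mem \<open>c \<noteq> d\<close> by auto
    with without[OF G(1)] without[OF G(2)] show False
      using mem by auto
  qed
qed

text \<open>The extremal case of the kernel \<open>{0, 1}\<close>: six subsets of
  \<open>{0, 1, 2}\<close> do not contain the kernel, as many as the upper bound permits.\<close>

definition cube_family :: "nat \<Rightarrow> nat set set" where
  "cube_family m = Pow {..<3} \<union> (\<lambda>i. {0, 1, i}) ` {3..<m}"

lemma cube_family_subset: "3 \<le> m \<Longrightarrow> cube_family m \<subseteq> Pow {..<m}"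
  by (auto simp: cube_family_def)

lemma card_cube_family:
  assumes "3 \<le> m"
  shows "card (cube_family m) = m + 5"
proof -
  have "inj_on (\<lambda>i::nat. {0, 1, i}) {3..<m}"
  proof (rule inj_onI)
    fix i j :: nat
    assume i: "i \<in> {3..<m}" and eq: "{0, 1, i} = {0, 1, j}"
    have "i \<in> {0, 1, i}"
      by simp
    also note eq
    finally show "i = j"
      using i by simp
  qed
  hence "card ((\<lambda>i::nat. {0, 1, i}) ` {3..<m}) = m - 3"
    by (simp add: card_image)
  moreover have "card (Pow {..<3::nat}) = 8"
    by (simp add: card_Pow)
  moreover have "Pow {..<3} \<inter> (\<lambda>i::nat. {0, 1, i}) ` {3..<m} = {}"
    by auto
  ultimately show ?thesis
    using assms card_Un_disjoint[of "Pow {..<3::nat}" "(\<lambda>i. {0, 1, i}) ` {3..<m}"]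
    by (simp add: cube_family_def)
qed

text \<open>Each member has at most one point outside \<open>{0, 1}\<close>, so the two private
  points of \<open>C\<close> prevent \<open>A\<close> and \<open>B\<close> from containing
  \<open>{0, 1}\<close>, and both lie in \<open>{0, 1, 2}\<close>. There is then no room: either
  four distinct points lie in \<open>{0, 1, 2}\<close>, or \<open>C\<close> takes \<open>0\<close>
  and \<open>1\<close> and leaves only \<open>2\<close> for both \<open>a\<close> and
  \<open>b\<close>.\<close>

lemma F9_free_cube_family: "F9_free (cube_family m)"
proof (rule F9_freeI)
  let ?G = "cube_family m"
  fix A B C a b c d
  assume G: "A \<in> ?G" "B \<in> ?G" "C \<in> ?G"
    and "a \<in> A - (B \<union> C)" "b \<in> B - (A \<union> C)" "c \<in> C - (A \<union> B)" "d \<in> C - (A \<union> B)" "c \<noteq> d"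
  hence mem: "a \<in> A" "a \<notin> B \<union> C" "b \<in> B" "b \<notin> A \<union> C" "c \<in> C" "c \<notin> A \<union> B" "d \<in> C" "d \<notin> A \<union> B"
    by auto
  have cases: "X \<subseteq> {0, 1, 2} \<or> (\<exists>i\<ge>3. X = {0, 1, i})" if "X \<in> ?G" for X
  proof -
    have "{..<3} = {0, 1, 2 :: nat}"
      by auto
    thus ?thesis
      using that unfolding cube_family_def by auto
  qed
  have "\<not> {0, 1} \<subseteq> A" "\<not> {0, 1} \<subseteq> B"
    using cases[OF G(3)] mem \<open>c \<noteq> d\<close> by auto
  hence AB: "A \<subseteq> {0, 1, 2}" "B \<subseteq> {0, 1, 2}"
    using cases[OF G(1)] cases[OF G(2)] by auto
  from cases[OF G(3)] show False
  proof
    assume "C \<subseteq> {0, 1, 2}"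
    hence "{a, b, c, d} \<subseteq> {0, 1, 2}"
      using AB mem by blast
    hence "card {a, b, c, d} \<le> card {0, 1, 2 :: nat}"
      by (intro card_mono) auto
    moreover have "card {a, b, c, d} = 4"
    proof -
      have "a \<noteq> b" "a \<noteq> c" "a \<noteq> d" "b \<noteq> c" "b \<noteq> d"
        using mem by auto
      thus ?thesis
        using \<open>c \<noteq> d\<close> by simp
    qed
    ultimately show False
      by simp
  next
    assume "\<exists>i\<ge>3. C = {0, 1, i}"
    hence "a = 2" "b = 2"
      using AB mem by auto
    thus False
      using mem by simp
  qed
qed

section \<open>The three values from the upper bounds and the extremal families\<close>

theorem corollary6p16:
  shows "\<exists>M. \<forall>m\<ge>M.
    forb m {ones_mat 3 1, F9} = m + 2 \<and>
    forb m {ones_mat 2 2, F9} = m + 3 \<and>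
    forb m {ones_mat 4 1, F9} = m + 5"
proof -
  obtain N where N: "\<And>m \<G>. \<G> \<subseteq> Pow {..<m :: nat} \<Longrightarrow> F9_free \<G> \<Longrightarrow> (\<forall>A\<in>\<G>. card A \<le> 3) \<Longrightarrow>
      N < card \<G> \<Longrightarrow> card \<G> \<le> m + 2 \<or>
      card \<G> \<le> m + 5 \<and> (\<exists>A\<in>\<G>. \<exists>B\<in>\<G>. A \<noteq> B \<and> card A = 3 \<and> card (A \<inter> B) = 2)"
    using F9_free_triples_bound by metis
  show ?thesis
  \<comment> \<open>Families with at most \<open>N\<close> members satisfy every bound once
    \<open>N \<le> m\<close>; the 5 supplies the hypothesis \<open>5 \<le> m\<close> of
    \<open>F9_free_linear_bound\<close>.\<close>
  proof (intro exI[of _ "N + 5"] allI impI conjI)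
    fix m assume m: "N + 5 \<le> m"
    let ?big = "insert {1..<m} (star_family m)"
    have sub: "?big \<subseteq> Pow {..<m}"
      using star_family_subset[of m] m by auto
    hence star: "star_family m \<subseteq> Pow {..<m}"
      by simp
    have cube: "cube_family m \<subseteq> Pow {..<m}"
      using cube_family_subset m by simp
    show "forb m {ones_mat 3 1, F9} = m + 2"
    proof (rule forb_eqI[OF star])
      show "card (star_family m) = m + 2"
        using card_star_family m by simp
      have "card X < 3" if "X \<in> star_family m" for X
        using that by (auto simp: star_family_def card_insert_if)
      moreover have "F9_free (star_family m)"
        using F9_free_star_family by (rule F9_free_subset) blast
      ultimately show "\<forall>F\<in>{ones_mat 3 1, F9}. \<not> family_config m F (star_family m)"
        unfolding avoids_ones_1_F9_iff[OF star] by blast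
    next
      fix \<H> assume H: "\<H> \<subseteq> Pow {..<m}" "\<forall>F\<in>{ones_mat 3 1, F9}. \<not> family_config m F \<H>"
      have free: "F9_free \<H>" and small: "\<And>X. X \<in> \<H> \<Longrightarrow> card X < 3"
        using H(2) unfolding avoids_ones_1_F9_iff[OF H(1)] by blast+
      have "\<forall>X\<in>\<H>. card X \<le> 3" "\<not> (\<exists>X\<in>\<H>. \<exists>Y\<in>\<H>. X \<noteq> Y \<and> card X = 3 \<and> card (X \<inter> Y) = 2)"
        using small by fastforce+
      hence "card \<H> \<le> N \<or> card \<H> \<le> m + 2"
        using N[OF H(1) free] by linarith
      thus "card \<H> \<le> m + 2"
        using m by linarith
    qed
    show "forb m {ones_mat 2 2, F9} = m + 3"
    proof (rule forb_eqI[OF sub])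
      have "{1..<m} \<notin> star_family m"
      proof -
        have star: "0 \<in> X \<or> X \<subseteq> {1}" if "X \<in> star_family m" for X
          using that by (auto simp: star_family_def)
        have "2 \<in> {1..<m}" "0 \<notin> {1..<m}"
          using m by auto
        moreover have "2 \<notin> {1 :: nat}"
          by simp
        ultimately show ?thesis
          using star[of "{1..<m}"] by blast
      qed
      moreover have "finite (star_family m)"
        by (simp add: star_family_def)
      ultimately show "card ?big = m + 3"
        using card_star_family m by simp
      have "card (X \<inter> Y) < 2" if XY: "X \<in> ?big" "Y \<in> ?big" "X \<noteq> Y" for X Y
      proof (rule ccontr)
        assume "\<not> ?thesis"
        then obtain c d where "c \<in> X \<inter> Y" "d \<in> X \<inter> Y" "c \<noteq> d"
          using card_ge_2E[of "X \<inter> Y"] by auto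
        thus False
          using XY by (auto simp: star_family_def)
      qed
      thus "\<forall>F\<in>{ones_mat 2 2, F9}. \<not> family_config m F ?big"
        unfolding avoids_ones_2_F9_iff[OF sub] using F9_free_star_family by blast
    next
      fix \<H> assume H: "\<H> \<subseteq> Pow {..<m}" "\<forall>F\<in>{ones_mat 2 2, F9}. \<not> family_config m F \<H>"
      have free: "F9_free \<H>" and linear: "\<And>X Y. X \<in> \<H> \<Longrightarrow> Y \<in> \<H> \<Longrightarrow> X \<noteq> Y \<Longrightarrow> card (X \<inter> Y) < 2"
        using H(2) unfolding avoids_ones_2_F9_iff[OF H(1)] by blast+
      show "card \<H> \<le> m + 3"
      \<comment> \<open>Linearity excludes the alternative with \<open>m + 5\<close>, so small sets
        give at most \<open>m + 2\<close>; only families with a larger member can reach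
        \<open>m + 3\<close>.\<close>
      proof (cases "\<forall>X\<in>\<H>. card X \<le> 3")
        case True
        moreover have "\<not> (\<exists>X\<in>\<H>. \<exists>Y\<in>\<H>. X \<noteq> Y \<and> card X = 3 \<and> card (X \<inter> Y) = 2)"
          using linear by fastforce
        ultimately have "card \<H> \<le> N \<or> card \<H> \<le> m + 2"
          using N[OF H(1) free] by linarith
        thus ?thesis
          using m by linarith
      next
        case False
        then obtain C where "C \<in> \<H>" "4 \<le> card C"
          by (auto simp: not_le)
        moreover have "card (X \<inter> Y) \<le> 1" if "X \<in> \<H>" "Y \<in> \<H>" "X \<noteq> Y" for X Y
          using linear[OF that] by simp
        ultimately show ?thesis
          using F9_free_linear_bound[OF H(1) free] m by simp
      qed
    qed
    show "forb m {ones_mat 4 1, F9} = m + 5"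
    proof (rule forb_eqI[OF cube])
      show "card (cube_family m) = m + 5"
        using card_cube_family m by simp
      have "card X < 4" if X: "X \<in> cube_family m" for X
      proof (cases "X \<subseteq> {..<3}")
        case True
        thus ?thesis
          using card_mono[OF _ True] by simp
      next
        case False
        then obtain i where "X = {0, 1, i}"
          using X by (auto simp: cube_family_def)
        thus ?thesis
          by (simp add: card_insert_if)
      qed
      thus "\<forall>F\<in>{ones_mat 4 1, F9}. \<not> family_config m F (cube_family m)"
        unfolding avoids_ones_1_F9_iff[OF cube] using F9_free_cube_family by blast
    next
      fix \<H> assume H: "\<H> \<subseteq> Pow {..<m}" "\<forall>F\<in>{ones_mat 4 1, F9}. \<not> family_config m F \<H>"
      have free: "F9_free \<H>" and small: "\<And>X. X \<in> \<H> \<Longrightarrow> card X < 4"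
        using H(2) unfolding avoids_ones_1_F9_iff[OF H(1)] by blast+
      have "\<forall>X\<in>\<H>. card X \<le> 3"
        using small by fastforce
      hence "card \<H> \<le> N \<or> card \<H> \<le> m + 5"
        using N[OF H(1) free] by linarith
      thus "card \<H> \<le> m + 5"
        using m by linarith
    qed
  qed
qed

end
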